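(* Let $p>7408848$ be a prime. Let $\mathcal{P}$ be the set of polynomials $P\in\mathbb{F}_p[x]$ of degree exactly $\frac{p-1}{2}$ whose range sum equals $p$, i.e. $\sum_{x\in\mathbb{F}_p}P(x)=p$, where each value $P(x)$ is regarded as an integer in $\{0,1,\dots,p-1\}$ and the sum is computed in $\mathbb{Z}$. Then $$\mathcal{P}=\Big\{\varepsilon (x-a)^{\frac{p-1}{2}}+1 \;:\; a\in\mathbb{F}_p,\ \varepsilon\in\{1,-1\}\Big\}\ \cup\ \Big\{\tfrac{p+1}{2}\big(\varepsilon (x-a)^{\frac{p-1}{2}}+1\big) \;:\; a\in\mathbb{F}_p,\ \varepsilon\in\{1,-1\}\Big\}.$$ Equivalently, up to affine substitutions $x\mapsto \alpha x+\beta$ ($\alpha,\beta\in\mathbb{F}_p$, $\alpha\neq 0$), there are exactly two polynomials in $\mathcal{P}$, namely $x^{\frac{p-1}{2}}+1$ and $\frac{p+1}{2}\big(x^{\frac{p-1}{2}}+1\big)$.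
   Context: Elements of $\mathbb{F}_p$ are identified with the integers $\{0,1,\dots,p-1\}$; in the coefficients, $\frac{p+1}{2}$ and $\pm1$ denote the corresponding elements of $\mathbb{F}_p$. *)

theory Defs
  imports "Berlekamp_Zassenhaus.Finite_Field"
begin

text \<open>
  The field with \<open>p\<close> elements is \<^typ>\<open>'p mod_ring\<close> with \<open>p = CARD('p)\<close> and
  \<open>'p\<close> of class \<^class>\<open>prime_card\<close>. The function \<^const>\<open>to_int_mod_ring\<close> sends a field
  element to its representative in \<open>{0..<p}\<close>, so the sum below is an integer sum.
\<close>

definition range_sum :: "'p::prime_card mod_ring poly \<Rightarrow> int" where
  "range_sum P = (\<Sum>x\<in>UNIV. to_int_mod_ring (poly P x))"

definition range_sum_polys :: "'p::prime_card mod_ring poly set" where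
  "range_sum_polys =
     {P. degree P = (CARD('p) - 1) div 2 \<and> range_sum P = int CARD('p)}"

definition affine_equiv :: "'a::field poly \<Rightarrow> 'a poly \<Rightarrow> bool" where
  "affine_equiv P Q \<longleftrightarrow> (\<exists>\<alpha> \<beta>. \<alpha> \<noteq> 0 \<and> Q = pcompose P [:\<beta>, \<alpha>:])"

end

theory Submission
  imports Defs "Berlekamp_Zassenhaus.Berlekamp_Type_Based"
begin

text \<open>
  Put \<open>p = 2 m + 1\<close> and let \<open>F = \<Prod>x. (X - x)\<^bsup>P(x)\<^esup>\<close>, a monic polynomial whose degree is the range
  sum of \<open>P\<close>, that is \<open>p\<close>. Its logarithmic derivative gives \<open>F' (X\<^sup>p - X) = - F P\<close>. So \<open>F'\<close> has
  degree \<open>m\<close> and \<open>F = X\<^sup>p + g\<close> with \<open>g\<close> of degree \<open>m + 1\<close>; comparing degrees again, \<open>P + g'\<close> is a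
  constant \<open>\<kappa>\<close>, and \<open>h = g + X\<close> satisfies \<open>\<kappa> (X\<^sup>p - X) = h (h' - 1 - \<kappa>)\<close>. After a translation that
  removes the coefficient of \<open>X\<^bsup>m - 1\<^esup>\<close> in \<open>P\<close>, this equation forces \<open>h = b X\<^bsup>m + 1\<^esup> + h\<^sub>1 X\<close> with
  \<open>h\<^sub>1 \<in> {1, 2}\<close>, which yields the two families.
\<close>

section \<open>Arithmetic in the prime field\<close>

lemma of_nat_mod_ring_neq_0:
  assumes "0 < k" and "k < CARD('p)"
  shows "(of_nat k :: 'p::prime_card mod_ring) \<noteq> 0"
  using assms of_nat_0_mod_ring_dvd[of k, where 'a = 'p] by (auto dest!: dvd_imp_le)

lemma to_int_mod_ring_nonneg: "0 \<le> to_int_mod_ring (x :: 'p::finite mod_ring)"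
  using range_to_int_mod_ring[where 'a = 'p] by (metis atLeastLessThan_iff rangeI)

lemma of_nat_nat_to_int_mod_ring:
  "of_nat (nat (to_int_mod_ring x)) = (x :: 'p::prime_card mod_ring)"
  by (metis to_int_mod_ring_nonneg of_int_of_int_mod_ring of_int_of_nat_eq nat_0_le
      of_int_mod_ring_to_int_mod_ring)

lemma prod_linear_mod_ring:
  "(\<Prod>y\<in>UNIV. [:- y, 1:]) = monom (1 :: 'p::prime_card mod_ring) CARD('p) - monom 1 1"
  unfolding poly_monom_identity_mod_p by simp

text \<open>This is Wilson's theorem, translated by \<open>x\<close>. The derivative of
  \<open>X^p - X\<close> is -1; the product rule applied to its factorization leaves, at
  \<open>x\<close>, only the summand that omits the factor \<open>X - x\<close>.\<close>

lemma prod_differences_mod_ring: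
  "(\<Prod>y\<in>UNIV - {x}. x - y) = (- 1 :: 'p::prime_card mod_ring)"
proof -
  have "pderiv (\<Prod>y\<in>UNIV. [:- y, 1:]) = (- 1 :: 'p mod_ring poly)"
    unfolding prod_linear_mod_ring by (simp add: pderiv_diff pderiv_monom monom_0 pCons_one)
  then have "(\<Sum>a\<in>UNIV. \<Prod>y\<in>UNIV - {a}. x - y) = - 1"
    by (auto simp: pderiv_prod pderiv_pCons poly_sum poly_prod dest: arg_cong[where f = "\<lambda>q. poly q x"])
  also have "(\<Sum>a\<in>UNIV. \<Prod>y\<in>UNIV - {a}. x - y) = (\<Sum>a\<in>{x}. \<Prod>y\<in>UNIV - {a}. x - y)"
    by (rule sum.mono_neutral_right) (auto intro: prod_zero)
  finally show ?thesis by simp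
qed

section \<open>The product \<open>F\<close> and its logarithmic derivative\<close>

definition value_multiset_poly :: "'p::prime_card mod_ring poly \<Rightarrow> 'p mod_ring poly" where
  "value_multiset_poly P = (\<Prod>x\<in>UNIV. [:- x, 1:] ^ nat (to_int_mod_ring (poly P x)))"

lemma monic_value_multiset_poly: "monic (value_multiset_poly P)"
  unfolding value_multiset_poly_def by (intro monic_prod monic_power) auto

lemma degree_value_multiset_poly: "int (degree (value_multiset_poly P)) = range_sum P"
  unfolding value_multiset_poly_def range_sum_def
  by (subst degree_prod_sum_eq) (auto simp: degree_power_eq to_int_mod_ring_nonneg)

text \<open>The logarithmic derivative of the product, cleared of its denominators, interpolates \<open>- P\<close>,
  because \<open>\<Prod>y\<noteq>x. x - y\<close> is \<open>- 1\<close>.\<close>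

lemma pderiv_value_multiset_poly:
  fixes P :: "'p::prime_card mod_ring poly"
  assumes "degree P < CARD('p)"
  shows "pderiv (value_multiset_poly P) * (monom 1 CARD('p) - monom 1 1) = - value_multiset_poly P * P"
proof -
  define e where "e x = nat (to_int_mod_ring (poly P x))" for x
  define W where "W = (\<Sum>x\<in>UNIV. smult (of_nat (e x)) (\<Prod>y\<in>UNIV - {x}. [:- y, 1:]))"
  have W: "W = - P"
  proof (rule poly_eqI_degree[where A = UNIV])
    fix z :: "'p mod_ring"
    have "poly W z = (\<Sum>x\<in>UNIV. of_nat (e x) * (\<Prod>y\<in>UNIV - {x}. z - y))"
      by (simp add: W_def poly_sum poly_prod)
    also have "\<dots> = (\<Sum>x\<in>{z}. of_nat (e x) * (\<Prod>y\<in>UNIV - {x}. z - y))"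
      by (rule sum.mono_neutral_right) (auto intro: prod_zero)
    also have "\<dots> = poly (- P) z"
      by (simp add: prod_differences_mod_ring e_def of_nat_nat_to_int_mod_ring)
    finally show "poly W z = poly (- P) z" .
  next
    have "degree (\<Prod>y\<in>UNIV - {x}. [:- y, 1:]) = CARD('p) - 1" for x :: "'p mod_ring"
      by (subst degree_prod_sum_eq) (auto simp: card_Diff_singleton)
    then have "degree W \<le> CARD('p) - 1"
      unfolding W_def by (intro degree_sum_le) (auto intro: order.trans[OF degree_smult_le])
    then show "degree W < card (UNIV :: 'p mod_ring set)"
      using zero_less_card_finite[where 'a = 'p] by (simp del: zero_less_card_finite)
  qed (use assms in auto)
  have "pderiv (value_multiset_poly P) * (\<Prod>y\<in>UNIV. [:- y, 1:]) = value_multiset_poly P * W"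
    unfolding W_def sum_distrib_left value_multiset_poly_def pderiv_prod sum_distrib_right
  proof (rule sum.cong)
    fix x :: "'p mod_ring"
    let ?q = "\<lambda>y. [:- y, 1:] ^ nat (to_int_mod_ring (poly P y))"
    have 1: "(\<Prod>y\<in>UNIV. [:- y, 1:]) = [:- x, 1:] * (\<Prod>y\<in>UNIV - {x}. [:- y, 1:])"
      by (rule prod.remove) auto
    have 2: "prod ?q UNIV = [:- x, 1:] ^ e x * prod ?q (UNIV - {x})"
      unfolding e_def by (rule prod.remove) auto
    \<comment> \<open>The factor \<open>X - x\<close> restores the exponent lost by differentiation,
      so the identity also covers \<open>e x = 0\<close>.\<close>
    have 3: "pderiv (?q x) * [:- x, 1:] = smult (of_nat (e x)) ([:- x, 1:] ^ e x)"
    proof (cases "e x")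
      case (Suc j)
      then show ?thesis
        unfolding e_def[symmetric] Suc pderiv_power_Suc
        by (simp add: pderiv_pCons mult_ac del: mult_pCons_left mult_pCons_right)
    qed (simp flip: e_def)
    have "prod ?q (UNIV - {x}) * pderiv (?q x) * (\<Prod>y\<in>UNIV. [:- y, 1:])
        = prod ?q (UNIV - {x}) * (pderiv (?q x) * [:- x, 1:]) * (\<Prod>y\<in>UNIV - {x}. [:- y, 1:])"
      unfolding 1 by (simp only: mult_ac)
    also have "\<dots> = prod ?q UNIV * smult (of_nat (e x)) (\<Prod>y\<in>UNIV - {x}. [:- y, 1:])"
      unfolding 2 3 by (simp add: mult_ac del: mult_pCons_left mult_pCons_right)
    finally show "prod ?q (UNIV - {x}) * pderiv (?q x) * (\<Prod>y\<in>UNIV. [:- y, 1:])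
        = prod ?q UNIV * smult (of_nat (e x)) (\<Prod>y\<in>UNIV - {x}. [:- y, 1:])" .
  qed auto
  then show ?thesis
    unfolding W prod_linear_mod_ring by simp
qed

section \<open>The differential equation for \<open>h\<close> and its solutions\<close>

text \<open>Here \<open>h = F - X\<^sup>p + X\<close>, where \<open>F\<close> is the product attached to \<open>P\<close>.\<close>

lemma range_sum_differential_equation:
  fixes P :: "'p::prime_card mod_ring poly"
  assumes card: "CARD('p) = 2 * m + 1" and m: "m > 0"
    and P: "degree P = m" "range_sum P = int CARD('p)"
  obtains h \<kappa> where "degree h = m + 1" and "P = [:\<kappa> + 1:] - pderiv h"
    and "smult \<kappa> (monom 1 CARD('p) - monom 1 1) = h * (pderiv h - [:1 + \<kappa>:])"
proof -
  let ?p = "CARD('p)"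
  define F where "F = value_multiset_poly P"
  define g where "g = F - monom 1 ?p"
  have degF: "degree F = ?p" and lcF: "coeff F ?p = 1"
    using degree_value_multiset_poly[of P] monic_value_multiset_poly[of P] P by (auto simp: F_def)
  have eqF: "pderiv F * (monom 1 ?p - monom 1 1) = - F * P"
    unfolding F_def by (rule pderiv_value_multiset_poly) (use P card in auto)
  have pdF: "pderiv F = pderiv g"
    by (simp add: g_def pderiv_diff pderiv_monom)
  have P0: "P \<noteq> 0" and F0: "F \<noteq> 0" using P degF m by auto
  have degZ: "degree (monom (1 :: 'p mod_ring) ?p - monom 1 1) = ?p"
    using m card by (subst degree_minus_eq_right) (auto simp: degree_monom_eq)
  have "pderiv F \<noteq> 0" using eqF P0 F0 by auto
  then have "degree (pderiv F) + ?p = degree F + degree P"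
    using arg_cong[OF eqF, of degree] degZ P0 F0 m card
    by (subst (asm) degree_mult_eq, auto simp: degree_mult_eq)
  then have degF': "degree (pderiv F) = m" using degF P by simp
  \<comment> \<open>Between \<open>m + 1\<close> and \<open>p\<close> the degree \<open>k\<close> is
    invertible in the field, so the vanishing coefficients of \<open>F'\<close> force those of
    \<open>F\<close> to vanish. The derivative cannot see degree \<open>p\<close>; there
    \<open>F\<close> is monic and \<open>X^p\<close> is subtracted.\<close>
  have coeff_g: "coeff g k = 0" if k: "k > m + 1" for k
  proof -
    consider "k > ?p" | "k = ?p" | "k < ?p" by linarith
    then show ?thesis
    proof cases
      case 3
      then obtain j where j: "k = Suc j" "j > m" using k by (cases k) auto
      then have "of_nat k * coeff F k = 0"
        using coeff_eq_0[of "pderiv F" j] degF' by (simp add: coeff_pderiv)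
      then have "coeff F k = 0" using of_nat_mod_ring_neq_0[of k, where 'p = 'p] 3 k by auto
      then show ?thesis using 3 by (simp add: g_def)
    qed (use lcF degF coeff_eq_0[of F k] in \<open>auto simp: g_def\<close>)
  qed
  have "coeff (pderiv F) m \<noteq> 0" using degF' \<open>pderiv F \<noteq> 0\<close> by auto
  then have lead_g: "coeff g (m + 1) \<noteq> 0" by (auto simp: pdF coeff_pderiv)
  have degg: "degree g = m + 1"
    using coeff_g lead_g by (intro antisym degree_le le_degree) auto
  \<comment> \<open>With \<open>X^p\<close> isolated, the right-hand side has degree at most
    \<open>m + 1 + m = p\<close>, so the cofactor \<open>g' + P\<close> must be constant.\<close>
  have eqg: "monom 1 ?p * (pderiv g + P) = monom 1 1 * pderiv g - g * P"
    using eqF unfolding pdF by (simp add: g_def algebra_simps)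
  have "degree (monom 1 1 * pderiv g - g * P) \<le> ?p"
  proof (rule degree_diff_le)
    show "degree (monom 1 1 * pderiv g) \<le> ?p"
      by (rule order.trans[OF degree_mult_le]) (use degF' pdF card in \<open>auto simp: degree_monom_eq\<close>)
    show "degree (g * P) \<le> ?p"
      by (rule order.trans[OF degree_mult_le]) (use P degg card in auto)
  qed
  moreover have "degree (monom 1 ?p * (pderiv g + P)) = ?p + degree (pderiv g + P)" if "pderiv g + P \<noteq> 0"
    using that by (subst degree_mult_eq) (auto simp: degree_monom_eq)
  ultimately have "degree (pderiv g + P) = 0" unfolding eqg by fastforce
  then obtain \<kappa> where \<kappa>: "pderiv g + P = [:\<kappa>:]" using degree0_coeffs by blast
  \<comment> \<open>For \<open>P = \<kappa> - g'\<close> the right-hand side of \<open>eqg\<close>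
    is \<open>(g + X) g' - \<kappa> g\<close>; in terms of \<open>h = g + X\<close> this is
    \<open>h (g' - \<kappa>) + \<kappa> X\<close>, whence the factored equation.\<close>
  define h where "h = g + monom 1 1"
  have pdh: "pderiv h = pderiv g + 1"
    by (simp add: h_def pderiv_add pderiv_monom monom_0 pCons_one)
  have PP: "P = [:\<kappa>:] - pderiv g" using \<kappa> by (simp add: algebra_simps)
  have \<kappa>1: "[:\<kappa> + 1:] = [:\<kappa>:] + 1"
    by (simp only: one_pCons add_pCons add_0)
  show ?thesis
  proof
    show "degree h = m + 1"
      unfolding h_def using m degg by (subst degree_add_eq_left) (auto simp: degree_monom_eq)
    show "P = [:\<kappa> + 1:] - pderiv h"
      unfolding pdh PP \<kappa>1 by simp
    have "smult \<kappa> (monom 1 ?p) = monom 1 1 * pderiv g - g * ([:\<kappa>:] - pderiv g)"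
      using eqg unfolding \<kappa> unfolding PP by simp
    then show "smult \<kappa> (monom 1 ?p - monom 1 1) = h * (pderiv h - [:1 + \<kappa>:])"
      unfolding pdh add.commute[of 1 \<kappa>] \<kappa>1 by (simp add: h_def smult_diff_right algebra_simps)
  qed
qed

text \<open>Multiplied by 2, the right-hand side is \<open>(h\<^sup>2)' - 2 (1 + \<kappa>) h\<close>, so \<open>h\<^sup>2\<close> has no terms of degree
  \<open>m + 3, \<dots>, p - 1\<close>. Together with the vanishing second coefficient this makes \<open>h\<close> a trinomial.\<close>

lemma normalized_differential_equation_solution:
  fixes h :: "'p::prime_card mod_ring poly"
  assumes card: "CARD('p) = 2 * m + 1" and m: "m > 1"
    and deg: "degree h = m + 1" and second: "coeff h m = 0"
    and ode: "smult \<kappa> (monom 1 CARD('p) - monom 1 1) = h * (pderiv h - [:1 + \<kappa>:])"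
  obtains b h1 where "h = monom b (m + 1) + monom h1 1" and "b \<noteq> 0"
    and "b\<^sup>2 = 2 * \<kappa>" and "3 * h1 = 2 * (1 + \<kappa>)" and "(h1 - 1) * (h1 - 2) = 0"
proof -
  define b where "b = coeff h (m + 1)"
  define R where "R = h - monom b (m + 1)"
  have b0: "b \<noteq> 0" using deg unfolding b_def by (metis add_is_0 degree_0 leading_coeff_0_iff zero_neq_one)
  have two: "(2 :: 'p mod_ring) \<noteq> 0"
    using of_nat_mod_ring_neq_0[of 2, where 'p = 'p] card m by simp
  \<comment> \<open>In the field \<open>2 * (m + 1) = p + 1 = 1\<close>, so \<open>m + 1\<close>,
    which is (p+1)/2, is the inverse of 2.\<close>
  have half: "2 * (1 + of_nat m) = (1 :: 'p mod_ring)"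
    using of_nat_card_eq_0[where 'a = 'p] by (simp add: card algebra_simps)
  have degR: "degree R \<le> 1"
  proof (rule ccontr)
    define d where "d = degree R"
    assume "\<not> degree R \<le> 1"
    then have d: "d \<ge> 2" by (simp add: d_def)
    then have Rd: "coeff R d \<noteq> 0" by (auto simp: d_def)
    have "d < m"
    proof (rule ccontr)
      assume "\<not> d < m"
      moreover have "coeff R m = 0" "coeff R (m + 1) = 0"
        using second by (auto simp: R_def b_def)
      moreover have "coeff R k = 0" if "k > m + 1" for k
        using that coeff_eq_0[of h k] deg by (auto simp: R_def)
      moreover have "d = m \<or> d = m + 1 \<or> d > m + 1" using \<open>\<not> d < m\<close> by linarith
      ultimately show False using Rd by blast
    qed
    have h: "h = monom b (m + 1) + R" by (simp add: R_def)
    have smult_2: "smult 2 q = q + q" for q :: "'p mod_ring poly"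
      using smult_add_left[of 1 1 q] by simp
    \<comment> \<open>In this degree only the cross term contributes: the square of the leading term
      sits in degree \<open>2 * m + 2\<close>, which is larger, and \<open>R * R\<close> has degree
      at most \<open>2 * d\<close>, which is smaller, as \<open>d < m\<close>.\<close>
    have "coeff (h * h) (m + 1 + d) = 2 * (b * coeff R d)"
    proof -
      have "h * h = monom b (m + 1) * monom b (m + 1) + smult 2 (monom b (m + 1) * R) + R * R"
        unfolding h by (simp only: smult_2 distrib_left distrib_right mult_ac add_ac)
      moreover have "coeff (R * R) (m + 1 + d) = 0"
        by (rule coeff_eq_0) (use \<open>d < m\<close> degree_mult_le[of R R] in \<open>simp add: d_def\<close>)
      ultimately show ?thesis using \<open>d < m\<close> by (simp add: coeff_monom_mult mult_monom)
    qed
    moreover have "pderiv (h * h) = smult 2 (smult \<kappa> (monom 1 CARD('p) - monom 1 1) + smult (1 + \<kappa>) h)"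
      unfolding ode by (simp add: pderiv_mult smult_2 right_diff_distrib)
    \<comment> \<open>Since \<open>m + 1 < m + d < p\<close>, neither \<open>h\<close> nor
      \<open>X^p - X\<close> has a term in this degree.\<close>
    then have "coeff (pderiv (h * h)) (m + d) = 0"
      using coeff_eq_0[of h "m + d"] deg d \<open>d < m\<close> card by simp
    ultimately have "of_nat (m + 1 + d) * (2 * (b * coeff R d)) = 0"
      by (simp add: coeff_pderiv)
    then show False
      using Rd b0 two of_nat_mod_ring_neq_0[of "m + 1 + d", where 'p = 'p] \<open>d < m\<close> card by simp
  qed
  define h0 where "h0 = coeff R 0"
  define h1 where "h1 = coeff R 1"
  have "R = monom h0 0 + monom h1 1"
    by (rule poly_eqI) (use degR in \<open>auto simp: h0_def h1_def coeff_eq_0 elim!: less_SucE\<close>)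
  then have h: "h = monom b (m + 1) + monom h1 1 + monom h0 0" by (simp add: R_def algebra_simps)
  define s where "s = (1 + of_nat m) * b"
  have s: "2 * s = b" using half by (simp add: s_def flip: mult.assoc)
  have "pderiv h - [:1 + \<kappa>:] = monom s m + monom (h1 - 1 - \<kappa>) 0"
    by (simp add: h s_def pderiv_add pderiv_monom monom_0)
  \<comment> \<open>As \<open>m > 1\<close>, the exponents \<open>2 * m + 1\<close>,
    \<open>m + 1\<close>, \<open>m\<close>, 1 and 0 are distinct and coefficients can be compared
    one by one.\<close>
  then have expand: "smult \<kappa> (monom 1 CARD('p) - monom 1 1)
    = monom (b * s) (2 * m + 1) + monom (b * (h1 - 1 - \<kappa>)) (m + 1) + monom (h1 * s) (m + 1)
      + monom (h1 * (h1 - 1 - \<kappa>)) 1 + monom (h0 * s) m + monom (h0 * (h1 - 1 - \<kappa>)) 0"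
    unfolding ode by (simp add: h mult_monom distrib_left distrib_right mult_2)
  note c = arg_cong[OF expand, of "\<lambda>q. coeff q _"]
  have c1: "b * s = \<kappa>" using c[of "2 * m + 1"] m card by simp
  have c2: "b * (h1 - 1 - \<kappa>) + h1 * s = 0" using c[of "m + 1"] m card by simp
  have c3: "h0 * s = 0" using c[of m] m card by simp
  have c4: "h1 * (h1 - 1 - \<kappa>) = - \<kappa>" using c[of 1] m card by simp
  have "s \<noteq> 0" using s b0 by auto
  then have "h0 = 0" using c3 by simp
  have "s * (3 * h1 - 2 * (1 + \<kappa>)) = b * (h1 - 1 - \<kappa>) + h1 * s"
    unfolding s[symmetric] by (simp add: algebra_simps)
  then have e1: "3 * h1 = 2 * (1 + \<kappa>)" using c2 \<open>s \<noteq> 0\<close> by simp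
  \<comment> \<open>This combination of the relations \<open>e1\<close> and \<open>c4\<close>
    eliminates \<open>\<kappa>\<close>.\<close>
  have "(h1 - 1) * (h1 - 2) = h1 * (3 * h1 - 2 * (1 + \<kappa>)) - (3 * h1 - 2 * (1 + \<kappa>)) - 2 * (h1 * (h1 - 1 - \<kappa>) + \<kappa>)"
    by (simp add: algebra_simps)
  then have e2: "(h1 - 1) * (h1 - 2) = 0" using e1 c4 by simp
  have "b\<^sup>2 = b * (2 * s)" by (simp only: s power2_eq_square)
  then have e3: "b\<^sup>2 = 2 * \<kappa>" by (simp flip: c1)
  show ?thesis
    by (rule that[OF _ b0 e3 e1 e2]) (use h \<open>h0 = 0\<close> in simp)
qed

text \<open>The root \<open>h1 = 2\<close> gives \<open>\<kappa> = 2\<close> and the family with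
  constant term 1; the root \<open>h1 = 1\<close> gives \<open>\<kappa> = 1/2\<close> and the family
  scaled by 1/2. The sign \<open>\<epsilon>\<close> reflects the two square roots \<open>b\<close>
  of \<open>2 * \<kappa>\<close>.\<close>

lemma normalized_range_sum_poly_classification:
  fixes P :: "'p::prime_card mod_ring poly"
  assumes card: "CARD('p) = 2 * m + 1" and m: "m > 1"
    and P: "degree P = m" "range_sum P = int CARD('p)" and second: "coeff P (m - 1) = 0"
  obtains \<epsilon> where "\<epsilon> \<in> {1, - 1}"
    and "P = smult \<epsilon> ([:0, 1:] ^ m) + 1 \<or> P = smult (of_nat (m + 1)) (smult \<epsilon> ([:0, 1:] ^ m) + 1)"
proof -
  have "m > 0" using m by simp
  obtain h \<kappa> where deg: "degree h = m + 1" and Ph: "P = [:\<kappa> + 1:] - pderiv h"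
    and ode: "smult \<kappa> (monom 1 CARD('p) - monom 1 1) = h * (pderiv h - [:1 + \<kappa>:])"
    using range_sum_differential_equation[OF card \<open>m > 0\<close> P] by blast
  \<comment> \<open>As \<open>m - 1 > 0\<close>, the constant \<open>\<kappa> + 1\<close> does not
    enter the coefficient of \<open>P\<close> in degree \<open>m - 1\<close>.\<close>
  have "of_nat m * coeff h m = 0"
    using second m by (cases m) (auto simp: Ph coeff_pderiv coeff_pCons split: nat.splits)
  then have "coeff h m = 0"
    using of_nat_mod_ring_neq_0[of m, where 'p = 'p] m card by simp
  then obtain b h1 where h: "h = monom b (m + 1) + monom h1 1"
    and b2: "b\<^sup>2 = 2 * \<kappa>" and \<kappa>: "3 * h1 = 2 * (1 + \<kappa>)" and h1: "(h1 - 1) * (h1 - 2) = 0"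
    using normalized_differential_equation_solution[OF card m deg _ ode] by blast
  have two: "(2 :: 'p mod_ring) \<noteq> 0"
    using of_nat_mod_ring_neq_0[of 2, where 'p = 'p] card m by simp
  define c where "c = (of_nat (m + 1) :: 'p mod_ring)"
  have half: "2 * c = 1"
    using of_nat_card_eq_0[where 'a = 'p] by (simp add: c_def card algebra_simps)
  have X: "[:0, 1:] ^ m = monom (1 :: 'p mod_ring) m" by (simp add: monom_altdef)
  have P': "P = [:\<kappa> + 1 - h1:] - monom (c * b) m"
    by (simp add: Ph h c_def pderiv_add pderiv_monom monom_0)
  from h1 consider "h1 = 1" | "h1 = 2" by auto
  then show ?thesis
  proof cases
    case 1
    then have "2 * \<kappa> = 1" using \<kappa> by (simp add: algebra_simps)
    then have "\<kappa> = c" using half two by (metis mult_left_cancel)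
    have "b\<^sup>2 = 1" using b2 \<open>2 * \<kappa> = 1\<close> by simp
    then have "b = 1 \<or> b = - 1" by (simp add: power2_eq_1_iff)
    moreover have "P = smult c (smult (- b) (monom 1 m) + 1)"
      using 1 \<open>\<kappa> = c\<close> by (simp add: P' smult_add_right smult_monom add_monom algebra_simps)
    ultimately show ?thesis using that[of "- b"] unfolding X c_def by auto
  next
    case 2
    then have "2 * \<kappa> = 2 * 2" using \<kappa> by (simp add: algebra_simps)
    then have "\<kappa> = 2" using two by (metis mult_left_cancel)
    have "(c * b)\<^sup>2 = (2 * c)\<^sup>2" using b2 \<open>\<kappa> = 2\<close> by (simp add: power_mult_distrib)
    then have "c * b = 1 \<or> c * b = - 1" unfolding half by (simp add: power2_eq_1_iff)
    moreover have "P = smult (- (c * b)) (monom 1 m) + 1"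
      using 2 \<open>\<kappa> = 2\<close> by (simp add: P' smult_monom pCons_one flip: minus_monom)
    ultimately show ?thesis using that[of "- (c * b)"] unfolding X by auto
  qed
qed

section \<open>Affine substitutions and reduction to the normalized case\<close>

lemma range_sum_pcompose_linear:
  fixes P :: "'p::prime_card mod_ring poly"
  assumes "\<alpha> \<noteq> 0"
  shows "range_sum (pcompose P [:\<beta>, \<alpha>:]) = range_sum P"
proof -
  have "bij (\<lambda>x. \<beta> + x * \<alpha>)"
    by (rule o_bij[where g = "\<lambda>y. (y - \<beta>) / \<alpha>"]) (use assms in \<open>auto simp: fun_eq_iff\<close>)
  from sum.reindex_bij_betw[OF this, of "\<lambda>x. to_int_mod_ring (poly P x)"] show ?thesis
    by (simp add: range_sum_def poly_pcompose)
qed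

text \<open>Completing the \<open>m\<close>-th power: \<open>a\<close> is chosen so that
  \<open>l (X - a)^m\<close> agrees with \<open>P\<close> in degrees \<open>m\<close> and
  \<open>m - 1\<close>. The difference is zero or of degree below \<open>m - 1\<close>, and
  translation preserves this.\<close>

lemma translation_kills_second_coeff:
  fixes P :: "'a::field poly"
  assumes deg: "degree P = m" and m: "m > 0" and "of_nat m \<noteq> (0 :: 'a)"
  obtains a where "coeff (pcompose P [:a, 1:]) (m - 1) = 0"
proof -
  define l where "l = coeff P m"
  define a where "a = - coeff P (m - 1) / (of_nat m * l)"
  have l: "l \<noteq> 0" using deg m by (auto simp: l_def)
  define R where "R = P - smult l ([:- a, 1:] ^ m)"
  have R: "coeff R k = 0" if k: "k \<ge> m - 1" for k
  proof -
    have deg_pow: "degree ([:- a, 1:] ^ m) = m" by (rule degree_linear_power)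
    consider "k > m" | "k = m" | "k = m - 1" using k by linarith
    then show ?thesis
    proof cases
      case 1
      then show ?thesis
        using deg deg_pow coeff_eq_0[of "[:- a, 1:] ^ m" k]
        by (simp add: R_def coeff_eq_0)
    next
      case 2
      then have "coeff ([:- a, 1:] ^ m) k = 1" by (subst coeff_linear_poly_power) auto
      then show ?thesis using 2 by (simp add: R_def l_def)
    next
      case 3
      then have "coeff ([:- a, 1:] ^ m) k = - (of_nat m * a)"
        using m binomial_symmetric[of "m - 1" m] by (subst coeff_linear_poly_power) auto
      then show ?thesis
        using 3 l assms by (simp add: R_def a_def)
    qed
  qed
  have "coeff (pcompose R [:a, 1:]) (m - 1) = 0"
  proof (cases "R = 0")
    case False
    then have "degree R < m - 1"
      using R[of "degree R"] by (metis leading_coeff_0_iff not_le)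
    then show ?thesis by (intro coeff_eq_0) (simp add: degree_pcompose)
  qed simp
  moreover have "P = smult l ([:- a, 1:] ^ m) + R" by (simp add: R_def)
  then have "pcompose P [:a, 1:] = smult l (monom 1 m) + pcompose R [:a, 1:]"
    by (simp add: pcompose_add pcompose_smult pcompose_hom.hom_power pcompose_pCons monom_altdef)
  ultimately show ?thesis using m that[of a] by simp
qed

lemma range_sum_poly_classification:
  fixes P :: "'p::prime_card mod_ring poly"
  assumes card: "CARD('p) = 2 * m + 1" and m: "m > 1"
    and P: "degree P = m" "range_sum P = int CARD('p)"
  obtains a \<epsilon> where "\<epsilon> \<in> {1, - 1}"
    and "P = smult \<epsilon> ([:- a, 1:] ^ m) + 1 \<or> P = smult (of_nat (m + 1)) (smult \<epsilon> ([:- a, 1:] ^ m) + 1)"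
proof -
  have "of_nat m \<noteq> (0 :: 'p mod_ring)"
    using of_nat_mod_ring_neq_0[of m, where 'p = 'p] card m by simp
  then obtain a where a: "coeff (pcompose P [:a, 1:]) (m - 1) = 0"
    using translation_kills_second_coeff[OF P(1)] m by auto
  define Q where "Q = pcompose P [:a, 1:]"
  have "degree Q = m" "range_sum Q = int CARD('p)"
    using P range_sum_pcompose_linear[of 1 P a] by (simp_all add: Q_def degree_pcompose)
  then obtain \<epsilon> where \<epsilon>: "\<epsilon> \<in> {1, - 1}" and
    Q: "Q = smult \<epsilon> ([:0, 1:] ^ m) + 1 \<or> Q = smult (of_nat (m + 1)) (smult \<epsilon> ([:0, 1:] ^ m) + 1)"
    using normalized_range_sum_poly_classification[OF card m] a unfolding Q_def by blast
  have "pcompose [:a, 1:] [:- a, 1:] = [:0, 1:]" by (simp add: pcompose_pCons)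
  then have "P = pcompose Q [:- a, 1:]"
    unfolding Q_def pcompose_assoc[symmetric] by (simp only: pcompose_idR)
  moreover have "pcompose [:0, 1:] q = q" for q :: "'p mod_ring poly"
    by (simp add: pcompose_pCons)
  ultimately have "P = smult \<epsilon> ([:- a, 1:] ^ m) + 1 \<or> P = smult (of_nat (m + 1)) (smult \<epsilon> ([:- a, 1:] ^ m) + 1)"
    using Q by (auto simp only: pcompose_add pcompose_smult pcompose_hom.hom_power pcompose_1)
  with \<epsilon> that show ?thesis by blast
qed

section \<open>The values of \<open>x^m\<close> and the range sums of the two model
  polynomials\<close>

lemma power_half_card_mod_ring:
  fixes x :: "'p::prime_card mod_ring"
  assumes "CARD('p) = 2 * m + 1" and "x \<noteq> 0"
  shows "x ^ m = 1 \<or> x ^ m = - 1"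
proof -
  have "x * (x ^ m)\<^sup>2 = x * 1"
    using fermat_theorem_mod_ring[of x] unfolding assms
    by (simp add: power2_eq_square mult_2 power_add)
  then show ?thesis using assms by (simp add: power2_eq_1_iff)
qed

text \<open>Each of the two equations has at most \<open>m\<close> roots, and together they account
  for all \<open>2 * m\<close> nonzero elements, so both bounds are attained.\<close>

lemma card_power_half_eq_mod_ring:
  assumes card: "CARD('p::prime_card) = 2 * m + 1" and m: "m > 0"
    and \<epsilon>: "\<epsilon> \<in> {1, - 1 :: 'p mod_ring}"
  shows "card {x. x ^ m = \<epsilon>} = m"
proof -
  have le: "card {x :: 'p mod_ring. x ^ m = c} \<le> m" for c
  proof -
    have "degree (monom 1 m - [:c:]) = m"
      using m by (subst degree_minus_eq_right) (auto simp: degree_monom_eq)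
    moreover from this have "monom 1 m - [:c:] \<noteq> 0" using m by auto
    ultimately show ?thesis
      using card_poly_roots_bound[of "monom 1 m - [:c:]"] by (simp add: poly_monom)
  qed
  have "{x. x ^ m = 1} \<union> {x. x ^ m = - 1} = (UNIV :: 'p mod_ring set) - {0}"
    using power_half_card_mod_ring[OF card] m by (auto simp: zero_power)
  then have "2 * m \<le> card {x :: 'p mod_ring. x ^ m = 1} + card {x :: 'p mod_ring. x ^ m = - 1}"
    using card_Un_le[of "{x :: 'p mod_ring. x ^ m = 1}" "{x. x ^ m = - 1}"] card
    by (simp add: card_Diff_singleton)
  then show ?thesis using le[of 1] le[of "- 1"] \<epsilon> by auto
qed

lemma sum_power_half_mod_ring:
  fixes \<phi> :: "'p::prime_card mod_ring \<Rightarrow> int"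
  assumes card: "CARD('p) = 2 * m + 1" and m: "m > 0"
  shows "(\<Sum>x\<in>UNIV. \<phi> (x ^ m)) = \<phi> 0 + int m * \<phi> 1 + int m * \<phi> (- 1)"
proof -
  have neq: "(1 :: 'p mod_ring) \<noteq> - 1"
    using of_nat_mod_ring_neq_0[of 2, where 'p = 'p] card m by (auto simp: eq_neg_iff_add_eq_0)
  have "(UNIV :: 'p mod_ring set) = insert 0 ({x. x ^ m = 1} \<union> {x. x ^ m = - 1})"
    using power_half_card_mod_ring[OF card] m by (auto simp: zero_power)
  then have "(\<Sum>x\<in>UNIV. \<phi> (x ^ m)) = (\<Sum>x\<in>insert 0 ({x. x ^ m = 1} \<union> {x. x ^ m = - 1}). \<phi> (x ^ m))"
    by simp
  also have "\<dots> = \<phi> 0 + (\<Sum>x\<in>{x. x ^ m = 1} \<union> {x. x ^ m = - 1}. \<phi> (x ^ m))"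
    using m by (subst sum.insert) (auto simp: zero_power)
  also have "\<dots> = \<phi> 0 + ((\<Sum>x | x ^ m = 1. \<phi> (x ^ m)) + (\<Sum>x | x ^ m = - 1. \<phi> (x ^ m)))"
    using neq by (subst sum.union_disjoint) auto
  finally show ?thesis by (simp add: card_power_half_eq_mod_ring[OF card m])
qed

lemma to_int_mod_ring_of_nat:
  "n < CARD('p) \<Longrightarrow> to_int_mod_ring (of_nat n :: 'p::prime_card mod_ring) = int n"
  by (simp add: of_nat_of_int_mod_ring)

text \<open>The representatives of the values at \<open>x^m = 0, 1, -1\<close> are 1, 2, 0 for the
  first polynomial and \<open>m + 1\<close>, 1, 0 for the second. With multiplicities 1,
  \<open>m\<close>, \<open>m\<close> both sums are \<open>2 * m + 1\<close>.\<close>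

lemma range_sum_power_half:
  assumes card: "CARD('p::prime_card) = 2 * m + 1" and m: "m > 0"
  shows "range_sum ([:0, 1:] ^ m + 1 :: 'p mod_ring poly) = int CARD('p)"
    and "range_sum (smult (of_nat (m + 1)) ([:0, 1:] ^ m + 1 :: 'p mod_ring poly)) = int CARD('p)"
proof -
  have [simp]: "to_int_mod_ring (2 :: 'p mod_ring) = 2"
    using to_int_mod_ring_of_nat[of 2, where 'p = 'p] card m by simp
  have [simp]: "to_int_mod_ring (1 + of_nat m :: 'p mod_ring) = int m + 1"
    using to_int_mod_ring_of_nat[of "m + 1", where 'p = 'p] card m by simp
  have [simp]: "2 + of_nat m * 2 = (1 :: 'p mod_ring)"
    using of_nat_card_eq_0[where 'a = 'p] by (simp add: card algebra_simps)
  show "range_sum ([:0, 1:] ^ m + 1 :: 'p mod_ring poly) = int CARD('p)"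
    using sum_power_half_mod_ring[OF card m, of "\<lambda>y. to_int_mod_ring (y + 1)"] card
    by (simp add: range_sum_def poly_power)
  show "range_sum (smult (of_nat (m + 1)) ([:0, 1:] ^ m + 1 :: 'p mod_ring poly)) = int CARD('p)"
    using sum_power_half_mod_ring[OF card m, of "\<lambda>y. to_int_mod_ring (of_nat (m + 1) * (y + 1))"] card
    by (simp add: range_sum_def poly_power)
qed

section \<open>Affine orbits and the classification\<close>

text \<open>Writing the substituted linear polynomial as \<open>\<alpha> (X - a)\<close> turns
  \<open>X^m\<close> into \<open>\<alpha>^m (X - a)^m\<close>. For nonzero \<open>\<alpha>\<close>
  the factor \<open>\<alpha>^m\<close> is a sign, and both signs occur.\<close>

lemma affine_equiv_power_half_iff:
  fixes P :: "'p::prime_card mod_ring poly"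
  assumes card: "CARD('p) = 2 * m + 1" and m: "m > 0"
  shows "affine_equiv (smult c ([:0, 1:] ^ m + 1)) P
    \<longleftrightarrow> (\<exists>a \<epsilon>. P = smult c (smult \<epsilon> ([:- a, 1:] ^ m) + 1) \<and> \<epsilon> \<in> {1, - 1})"
proof -
  have X: "pcompose [:0, 1:] q = q" for q :: "'p mod_ring poly"
    by (simp add: pcompose_pCons)
  have comp: "pcompose (smult c ([:0, 1:] ^ m + 1)) (smult \<alpha> [:- a, 1:])
      = smult c (smult (\<alpha> ^ m) ([:- a, 1:] ^ m) + 1)" for \<alpha> a :: "'p mod_ring"
    by (simp only: pcompose_add pcompose_smult pcompose_hom.hom_power pcompose_1 X smult_power)
  show ?thesis
  proof
    assume "affine_equiv (smult c ([:0, 1:] ^ m + 1)) P"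
    then obtain \<alpha> \<beta> where \<alpha>: "\<alpha> \<noteq> 0" and "P = pcompose (smult c ([:0, 1:] ^ m + 1)) [:\<beta>, \<alpha>:]"
      unfolding affine_equiv_def by blast
    moreover have "[:\<beta>, \<alpha>:] = smult \<alpha> [:- (- \<beta> / \<alpha>), 1:]" using \<alpha> by simp
    ultimately have "P = smult c (smult (\<alpha> ^ m) ([:- (- \<beta> / \<alpha>), 1:] ^ m) + 1)"
      using comp[of \<alpha> "- \<beta> / \<alpha>"] by metis
    then show "\<exists>a \<epsilon>. P = smult c (smult \<epsilon> ([:- a, 1:] ^ m) + 1) \<and> \<epsilon> \<in> {1, - 1}"
      using power_half_card_mod_ring[OF card \<alpha>] by blast
  next
    assume "\<exists>a \<epsilon>. P = smult c (smult \<epsilon> ([:- a, 1:] ^ m) + 1) \<and> \<epsilon> \<in> {1, - 1}"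
    then obtain a \<epsilon> where P: "P = smult c (smult \<epsilon> ([:- a, 1:] ^ m) + 1)" and \<epsilon>: "\<epsilon> \<in> {1, - 1}"
      by blast
    have "{x. x ^ m = \<epsilon>} \<noteq> {}"
      using card_power_half_eq_mod_ring[OF card m \<epsilon>] m by (metis card.empty less_irrefl)
    then obtain \<alpha> where "\<alpha> ^ m = \<epsilon>" by blast
    moreover from this have "\<alpha> \<noteq> 0" using \<epsilon> m by (auto simp: zero_power)
    moreover have "smult \<alpha> [:- a, 1:] = [:- (\<alpha> * a), \<alpha>:]" by simp
    ultimately show "affine_equiv (smult c ([:0, 1:] ^ m + 1)) P"
      unfolding affine_equiv_def P using comp[of \<alpha> a] by metis
  qed
qed

theorem theorem1p1:
  fixes p :: nat and f g :: "'p::prime_card mod_ring poly"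
  assumes "p = CARD('p)" and "p > 7408848"
  defines "f \<equiv> [:0, 1:] ^ ((p - 1) div 2) + 1"
    and "g \<equiv> smult (of_nat ((p + 1) div 2)) ([:0, 1:] ^ ((p - 1) div 2) + 1)"
  shows "(range_sum_polys :: 'p mod_ring poly set) =
           {smult \<epsilon> ([:- a, 1:] ^ ((p - 1) div 2)) + 1 | a \<epsilon>. \<epsilon> \<in> {1, - 1}} \<union>
           {smult (of_nat ((p + 1) div 2)) (smult \<epsilon> ([:- a, 1:] ^ ((p - 1) div 2)) + 1)
             | a \<epsilon>. \<epsilon> \<in> {1, - 1}}
         \<and> range_sum_polys = {P. affine_equiv f P} \<union> {P. affine_equiv g P}
         \<and> \<not> affine_equiv f g"
proof -
  define m where "m = (p - 1) div 2"
  have "odd p"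
    using prime_card[where 'a = 'p] assms(1,2) prime_odd_nat[of p] by auto
  then have p: "p = 2 * m + 1" unfolding m_def by (auto elim: oddE)
  then have card: "CARD('p) = 2 * m + 1" and m: "m > 1" and m0: "m > 0"
    using assms(1,2) by auto
  have pm: "(p - 1) div 2 = m" "(p + 1) div 2 = m + 1" using p by auto
  define c where "c = (of_nat (m + 1) :: 'p mod_ring)"
  have half: "2 * c = 1"
    using of_nat_card_eq_0[where 'a = 'p] by (simp add: c_def card algebra_simps)
  have f: "f = [:0, 1:] ^ m + 1" and g: "g = smult c ([:0, 1:] ^ m + 1)"
    unfolding f_def g_def pm c_def by (rule refl)+
  have equiv_f: "affine_equiv f P \<longleftrightarrow> (\<exists>a \<epsilon>. P = smult \<epsilon> ([:- a, 1:] ^ m) + 1 \<and> \<epsilon> \<in> {1, - 1})" for P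
    using affine_equiv_power_half_iff[OF card m0, of 1 P] unfolding f smult_1_left .
  have equiv_g: "affine_equiv g P
      \<longleftrightarrow> (\<exists>a \<epsilon>. P = smult c (smult \<epsilon> ([:- a, 1:] ^ m) + 1) \<and> \<epsilon> \<in> {1, - 1})" for P
    unfolding g by (rule affine_equiv_power_half_iff[OF card m0])
  have "c \<noteq> 0" using half by auto
  have "degree f = m"
    unfolding f using m0 degree_linear_power[of "0 :: 'p mod_ring" m]
    by (subst degree_add_eq_left) auto
  then have "f \<in> range_sum_polys" "g \<in> range_sum_polys"
    using range_sum_power_half[OF card m0] \<open>c \<noteq> 0\<close>
    unfolding range_sum_polys_def g f c_def card by auto
  then have closed: "P \<in> range_sum_polys" if "affine_equiv f P \<or> affine_equiv g P" for P
    using that unfolding range_sum_polys_def affine_equiv_def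
    by (auto simp: range_sum_pcompose_linear degree_pcompose)
  have "affine_equiv f P \<or> affine_equiv g P" if "P \<in> range_sum_polys" for P :: "'p mod_ring poly"
  proof -
    have "degree P = m" "range_sum P = int CARD('p)"
      using that by (auto simp: range_sum_polys_def card)
    then show ?thesis
      using range_sum_poly_classification[OF card m] unfolding equiv_f equiv_g c_def by metis
  qed
  with closed have orbits: "range_sum_polys = {P. affine_equiv f P} \<union> {P. affine_equiv g P}"
    by blast
  have "\<not> affine_equiv f g"
  proof
    assume "affine_equiv f g"
    then obtain a \<epsilon> where eq: "g = smult \<epsilon> ([:- a, 1:] ^ m) + 1" and \<epsilon>: "\<epsilon> \<in> {1, - 1}"
      unfolding equiv_f by blast
    have lead: "coeff ([:b, 1:] ^ m) m = 1" for b :: "'p mod_ring"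
      by (subst coeff_linear_poly_power) auto
    have "coeff g m = c" using lead[of 0] m0 unfolding g by simp
    moreover have "coeff g m = \<epsilon>" using lead[of "- a"] m0 unfolding eq by simp
    ultimately have "c = \<epsilon>" by simp
    then have "2 * \<epsilon> - 1 = 0" using half by simp
    \<comment> \<open>The orbit of \<open>f\<close> has leading coefficients 1 and -1, so
      equivalence would make 1/2 a sign. As \<open>\<epsilon>^2 = 1\<close>, the product is
      \<open>4 - 1\<close>, and 3 would vanish in the field.\<close>
    moreover have "(3 :: 'p mod_ring) = (2 * \<epsilon> - 1) * (2 * \<epsilon> + 1)" using \<epsilon> by auto
    ultimately have "(3 :: 'p mod_ring) = 0" by simp
    then show False
      using of_nat_mod_ring_neq_0[of 3, where 'p = 'p] assms(1,2) by simp
  qed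
  then show ?thesis
    unfolding pm c_def[symmetric] orbits equiv_f equiv_g by auto
qed

end
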